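(* Let $\mathcal{G}=\langle a,b,c,d\rangle$ be the group of automorphisms of the rooted binary tree $\mathcal{T}$ defined in the context, let $d(H)$ denote the minimal number of generators of a group $H$, and let $\log$ denote the logarithm with base $2$. There is a constant $D$ such that the inequalities $$\frac{1}{D}\log(d(H))\leq \log\log([\mathcal{G}:H])\leq D\log(d(H))$$ hold for all subgroups $H=st_{\mathcal{G}}(v)$, where $v$ runs over the set of vertices of $\mathcal{T}$. In fact, for $H=st_{\mathcal{G}}(v)$, $$\frac{d(H)-1}{[\mathcal{G}:H]}=\frac{n+3}{2^n}$$ if $v$ is a vertex of level $n\geq 2$.
   Context: The vertices of the rooted binary tree $\mathcal{T}$ are the finite words over $\{0,1\}$ (the root is the empty word; the children of $w$ are $w0,w1$); the level of a vertex is its length as a word. $\mathcal{G}$ is the group generated, under composition, by the tree automorphisms $a,b,c,d$ fixing the empty word and given recursively, for all $w\in\{0,1\}^*$, by $a(0w)=1w$, $a(1w)=0w$; $b(0w)=0a(w)$, $b(1w)=1c(w)$; $c(0w)=0a(w)$, $c(1w)=1d(w)$; $d(0w)=0w$, $d(1w)=1b(w)$. For a vertex $v$, $st_{\mathcal{G}}(v)=\{g\in\mathcal{G}: g(v)=v\}$ is its stabilizer, which has index $2^n$ in $\mathcal{G}$ if $v$ is a vertex of level $n$.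
   Formalization: The printed value (n+3)/2^n is corrected to (n+2)/2^n, since d(st(v)) = n+3 at level n; the inequality (1/D)log d(H) ≤ loglog[G:H] is claimed only for levels n ≥ 2, since at level 1 loglog 2 = 0 < log d(H) and at the root loglog 1 is undefined. *)

theory Defs
  imports Complex_Main "HOL-Algebra.Bij" "HOL-Algebra.Generated_Groups"
begin

text \<open>Vertices of the binary tree are words of type \<open>bool list\<close>, with \<open>False\<close> for the letter 0 and
  \<open>True\<close> for the letter 1; the level of a vertex is its length. The recursion reads a word from
  the root, so that the children of \<open>w\<close> are \<open>w @ [False]\<close> and \<open>w @ [True]\<close>.\<close>

fun ga :: "bool list \<Rightarrow> bool list" where
  "ga [] = []"
| "ga (x # w) = (\<not> x) # w"

fun gb gc gd :: "bool list \<Rightarrow> bool list" where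
  "gb [] = []"
| "gb (False # w) = False # ga w"
| "gb (True # w) = True # gc w"
| "gc [] = []"
| "gc (False # w) = False # ga w"
| "gc (True # w) = True # gd w"
| "gd [] = []"
| "gd (False # w) = False # w"
| "gd (True # w) = True # gb w"

definition Grig :: "(bool list \<Rightarrow> bool list) monoid" where
  "Grig = (BijGroup UNIV)\<lparr>carrier := generate (BijGroup UNIV) {ga, gb, gc, gd}\<rparr>"

definition st :: "bool list \<Rightarrow> (bool list \<Rightarrow> bool list) set" where
  "st v = {g \<in> carrier Grig. g v = v}"

text \<open>The value is meaningful only for finitely generated groups: otherwise the set of
  admissible \<open>k\<close> is empty and \<open>LEAST\<close> is unspecified.\<close>

definition min_gens :: "('a, 'b) monoid_scheme \<Rightarrow> nat" where
  "min_gens G = (LEAST k. \<exists>S. S \<subseteq> carrier G \<and> finite S \<and> card S = k \<and> generate G S = carrier G)"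

abbreviation d_st :: "bool list \<Rightarrow> nat" where
  "d_st v \<equiv> min_gens (Grig\<lparr>carrier := st v\<rparr>)"

abbreviation index_st :: "bool list \<Rightarrow> nat" where
  "index_st v \<equiv> card (rcosets\<^bsub>Grig\<^esub> (st v))"

text \<open>Two points about the estimates relating \<open>d_st\<close> and \<open>index_st\<close>.

  The quotient \<open>(d - 1) / index\<close> at level \<open>n \<ge> 2\<close> is \<open>(n + 2) / 2 ^ n\<close>, not \<open>(n + 3) / 2 ^ n\<close>. At level 2,
  for instance, the Schreier graph of the orbit of 11 is the path 11, 01, 00, 10; reading off
  Schreier generators shows that the stabilizer of 11 is generated by the five elements
  \<open>b\<close>, \<open>c\<close>, \<open>ada\<close>, \<open>abababa\<close>, \<open>abacaba\<close>.

  At level 1 the index is 2, so \<open>log 2 (log 2 index) = 0\<close>, while the stabilizer is not cyclic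
  (it contains \<open>b\<close> and \<open>aca\<close>, which do not commute); hence no positive multiple of
  \<open>log 2 d\<close> is a lower bound there. At the root, \<open>log log 1\<close> is minus infinity, but HOL has
  \<open>log 2 (log 2 1) = log 2 0 = 0\<close>; the upper bound is not affected, as it only becomes stronger.\<close>

end

theory Submission
  imports Defs
begin

text \<open>All stabilizers of level \<open>n\<close> are conjugate to \<open>P n = st (1 ^ n)\<close>, and \<open>P (n + 1)\<close> consists of
  the \<open>(x, y) \<in> Gr\<close> with \<open>y \<in> P n\<close>. An element \<open>(x, 1)\<close> lies in \<open>Gr\<close> only if \<open>x\<close> lies in the normal
  closure of \<open>b\<close>, and \<open>(b, 1) = ada\<close>; hence lifts of generators of \<open>P n\<close>, chosen such that
  conjugating by them spreads \<open>(b, 1)\<close> over all \<open>(x, 1)\<close>, generate \<open>P (n + 1)\<close> together with \<open>ada\<close>.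
  As \<open>P 0 = \<langle>a, b, c\<rangle>\<close>, this gives \<open>n + 3\<close> generators.
  Conversely, \<open>(x, y) \<mapsto>\<close> the parity of the number of letters \<open>b\<close> and \<open>c\<close> in \<open>x\<close> is a homomorphism
  \<open>P (n + 1) \<rightarrow> Z/2\<close> that is 1 on \<open>(b, 1)\<close>; with the homomorphisms pulled back from \<open>P n\<close>, and
  \<open>Gr \<rightarrow> (Z/2) ^ 3\<close> for \<open>n = 0\<close>, it yields a surjection of \<open>P n\<close> onto \<open>(Z/2) ^ (n + 3)\<close>.\<close>

section \<open>Minimal numbers of generators\<close>

text \<open>As \<open>S\<close> is closed under inverses, every element of
  \<open>generate G S\<close> is a product of members of \<open>S\<close>. The induction shows that
  left multiplication by \<open>g\<close> preserves \<open>P\<close> on the generated subgroup, and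
  this is then applied to the unit.\<close>

lemma (in group) generate_left_induct:
  assumes S: "S \<subseteq> carrier G" "\<forall>s \<in> S. inv s \<in> S"
    and g: "g \<in> generate G S"
    and one: "P \<one>"
    and mult: "\<And>s g. s \<in> S \<Longrightarrow> g \<in> generate G S \<Longrightarrow> P g \<Longrightarrow> P (s \<otimes> g)"
  shows "P g"
proof -
  have "\<forall>h \<in> generate G S. P h \<longrightarrow> P (g \<otimes> h)"
    using g
  proof (induction rule: generate.induct)
    case one
    then show ?case
      using generate_in_carrier[OF S(1)] by simp
  next
    case (incl s)
    then show ?case by (blast intro: mult)
  next
    case (inv s)
    then show ?case using S(2) by (blast intro: mult)
  next
    case (eng g1 g2)
    show ?case
    proof (intro ballI impI)
      fix h assume h: "h \<in> generate G S" "P h"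
      then have "P (g1 \<otimes> (g2 \<otimes> h))"
        using eng by (blast intro: generate.eng)
      then show "P (g1 \<otimes> g2 \<otimes> h)"
        using eng(1,2) h(1) generate_in_carrier[OF S(1)] by (simp add: m_assoc)
    qed
  qed
  then have "P (g \<otimes> \<one>)"
    using one generate.one by blast
  then show ?thesis
    using g generate_in_carrier[OF S(1)] by simp
qed

text \<open>Under symmetric difference sets form an elementary abelian 2-group, in which each
  further generator at most doubles the image of \<open>X\<close>.\<close>

lemma (in group) image_generate_sym_diff:
  fixes X :: "'a \<Rightarrow> 'c set"
  assumes X: "\<And>x y. x \<in> carrier G \<Longrightarrow> y \<in> carrier G \<Longrightarrow> X (x \<otimes> y) = sym_diff (X x) (X y)"
    and "finite S" "S \<subseteq> carrier G"
  shows "finite (X ` generate G S) \<and> card (X ` generate G S) \<le> 2 ^ card S"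
  using assms(2,3)
proof (induction S)
  case empty
  then show ?case by (simp add: generate_empty)
next
  case (insert s S)
  let ?Y = "X ` generate G S"
  \<comment> \<open>The old image together with its translate by \<open>X s\<close>: closed under
    symmetric difference and at most twice as large.\<close>
  let ?Z = "?Y \<union> sym_diff (X s) ` ?Y"
  have S: "s \<in> carrier G" "S \<subseteq> carrier G"
    using insert.prems by auto
  have Xone: "X \<one> = {}"
    using X[of \<one> \<one>] by auto
  have Xinv: "X (inv x) = X x" if "x \<in> carrier G" for x
    using X[of x "inv x"] that Xone by auto
  have Y: "sym_diff A B \<in> ?Y" if A: "A \<in> ?Y" and B: "B \<in> ?Y" for A B
  proof -
    obtain g h where gh: "g \<in> generate G S" "A = X g" "h \<in> generate G S" "B = X h"
      using A B by auto
    then have "X (g \<otimes> h) = sym_diff A B"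
      using generate_in_carrier[OF S(2)] by (simp add: X)
    then show ?thesis
      using gh generate.eng[of g G S h] by (metis imageI)
  qed
  have Zex: "\<exists>A' \<in> ?Y. A = A' \<or> A = sym_diff (X s) A'" if "A \<in> ?Z" for A
    using that by blast
  have Z: "sym_diff A B \<in> ?Z" if AZ: "A \<in> ?Z" and BZ: "B \<in> ?Z" for A B
  proof -
    obtain A' B' where AB: "A' \<in> ?Y" "B' \<in> ?Y" "A = A' \<or> A = sym_diff (X s) A'"
      "B = B' \<or> B = sym_diff (X s) B'"
      using Zex[OF AZ] Zex[OF BZ] by blast
    have "sym_diff A B = sym_diff A' B' \<or> sym_diff A B = sym_diff (X s) (sym_diff A' B')"
      using AB(3,4) by blast
    then show ?thesis
      using Y[OF AB(1,2)] by auto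
  qed
  have Yone: "{} \<in> ?Y"
    using Xone generate.one[of G S] by (metis imageI)
  have sub: "X g \<in> ?Z" if "g \<in> generate G (insert s S)" for g
    using that
  proof (induction rule: generate.induct)
    case one
    show ?case using Yone Xone by blast
  next
    case (incl h)
    have "X s \<in> sym_diff (X s) ` ?Y"
      by (rule image_eqI[OF _ Yone]) simp
    then show ?case
      using incl generate.incl[of h S G] by auto
  next
    case (inv h)
    have "X s \<in> sym_diff (X s) ` ?Y"
      by (rule image_eqI[OF _ Yone]) simp
    moreover have "X (inv h) = X h"
      using inv insert.prems by (intro Xinv) blast
    ultimately show ?case
      using inv generate.incl[of h S G] by auto
  next
    case (eng h1 h2)
    then have "X (h1 \<otimes> h2) = sym_diff (X h1) (X h2)"
      using generate_in_carrier[OF insert.prems] by (simp add: X)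
    then show ?case
      using Z[OF eng.IH] by simp
  qed
  have Y': "finite ?Y" "card ?Y \<le> 2 ^ card S"
    using insert.IH S by auto
  have "card ?Z \<le> card ?Y + card (sym_diff (X s) ` ?Y)"
    by (rule card_Un_le)
  also have "\<dots> \<le> 2 ^ card S + 2 ^ card S"
    using Y' card_image_le[OF Y'(1), of "sym_diff (X s)"] by linarith
  also have "\<dots> = 2 ^ card (insert s S)"
    using insert.hyps by simp
  finally have "card ?Z \<le> 2 ^ card (insert s S)" .
  moreover have "finite ?Z"
    using Y' by simp
  moreover have "X ` generate G (insert s S) \<subseteq> ?Z"
    using sub by blast
  ultimately show ?case
    by (meson card_mono finite_subset le_trans)
qed

lemma min_gens_le:
  assumes "S \<subseteq> carrier G" "finite S" "generate G S = carrier G"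
  shows "min_gens G \<le> card S"
  unfolding min_gens_def by (rule Least_le) (use assms in blast)

lemma min_gens_witness:
  assumes "T \<subseteq> carrier G" "finite T" "generate G T = carrier G"
  obtains S where "S \<subseteq> carrier G" "finite S" "card S = min_gens G" "generate G S = carrier G"
proof -
  have "\<exists>S. S \<subseteq> carrier G \<and> finite S \<and> card S = min_gens G \<and> generate G S = carrier G"
    unfolding min_gens_def by (rule LeastI[of _ "card T"]) (use assms in blast)
  then show ?thesis
    using that by blast
qed

text \<open>Comparing \<open>2 ^ card I\<close> with the size of the image of \<open>X\<close> gives
  the bound. The finite generating set \<open>T\<close> guarantees that the minimum in
  \<open>min_gens G\<close> is attained.\<close>

lemma (in group) min_gens_lower_bound:
  fixes X :: "'a \<Rightarrow> 'c set"
  assumes X: "\<And>x y. x \<in> carrier G \<Longrightarrow> y \<in> carrier G \<Longrightarrow> X (x \<otimes> y) = sym_diff (X x) (X y)"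
    and surj: "Pow I \<subseteq> X ` carrier G"
    and T: "T \<subseteq> carrier G" "finite T" "generate G T = carrier G"
  shows "card I \<le> min_gens G"
proof -
  obtain S where S: "S \<subseteq> carrier G" "finite S" "card S = min_gens G" "generate G S = carrier G"
    using min_gens_witness[OF T] .
  have fin: "finite (X ` carrier G)" and le: "card (X ` carrier G) \<le> 2 ^ min_gens G"
    using image_generate_sym_diff[of X S] X S by auto
  have "finite (Pow I)"
    using fin surj finite_subset by blast
  then have "2 ^ card I = card (Pow I)"
    by (simp add: card_Pow)
  also have "\<dots> \<le> 2 ^ min_gens G"
    using card_mono[OF fin surj] le by linarith
  finally show ?thesis by simp
qed

lemma (in group_hom) generating_set_image:
  assumes iso: "h \<in> iso G H"
    and "\<exists>S. S \<subseteq> carrier G \<and> finite S \<and> card S = k \<and> generate G S = carrier G"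
  shows "\<exists>S. S \<subseteq> carrier H \<and> finite S \<and> card S = k \<and> generate H S = carrier H"
proof -
  obtain S where S: "S \<subseteq> carrier G" "finite S" "card S = k" "generate G S = carrier G"
    using assms(2) by blast
  have bij: "bij_betw h (carrier G) (carrier H)"
    using iso by (simp add: iso_def)
  then have im: "h ` carrier G = carrier H"
    by (simp add: bij_betw_def)
  have "inj_on h S"
    using bij S(1) by (meson bij_betw_def inj_on_subset)
  then have "card (h ` S) = k"
    using S(3) by (simp add: card_image)
  moreover have "generate H (h ` S) = carrier H"
    using generate_img[OF S(1)] S(4) im by simp
  moreover have "h ` S \<subseteq> carrier H"
    using S(1) im by blast
  ultimately show ?thesis
    using S(2) by blast
qed

text \<open>An isomorphism and its inverse transport generating sets of each size \<open>k\<close>,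
  so the two predicates under \<open>LEAST\<close> coincide.\<close>

lemma min_gens_iso:
  assumes G: "group G" and H: "group H" and \<phi>: "\<phi> \<in> iso G H"
  shows "min_gens G = min_gens H"
proof -
  let ?\<psi> = "inv_into (carrier G) \<phi>"
  have \<psi>: "?\<psi> \<in> iso H G"
    using group.iso_set_sym[OF G \<phi>] .
  have hom: "group_hom G H \<phi>" "group_hom H G ?\<psi>"
    using G H \<phi> \<psi> by (simp_all add: group_hom_def group_hom_axioms_def iso_def)
  have "(\<exists>S. S \<subseteq> carrier G \<and> finite S \<and> card S = k \<and> generate G S = carrier G)
      \<longleftrightarrow> (\<exists>S. S \<subseteq> carrier H \<and> finite S \<and> card S = k \<and> generate H S = carrier H)" for k
    using group_hom.generating_set_image[OF hom(1) \<phi>] group_hom.generating_set_image[OF hom(2) \<psi>]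
    by (rule iffI)
  then show ?thesis
    by (simp only: min_gens_def)
qed

section \<open>Groups of permutations of words\<close>

abbreviation U :: "(bool list \<Rightarrow> bool list) monoid" where
  "U \<equiv> BijGroup UNIV"

interpretation U: group U
  by (rule group_BijGroup)

lemma carrier_U: "carrier U = {f. bij f}"
  by (simp add: BijGroup_def Bij_def)

lemma one_U [simp]: "\<one>\<^bsub>U\<^esub> = id"
  by (simp add: BijGroup_def restrict_def id_def)

lemma mult_U: "bij f \<Longrightarrow> bij g \<Longrightarrow> f \<otimes>\<^bsub>U\<^esub> g = f \<circ> g"
  by (auto simp: BijGroup_def Bij_def compose_def)

lemma subgroup_U_comp:
  assumes "subgroup H U" "f \<in> H" "g \<in> H"
  shows "f \<circ> g \<in> H"
proof -
  have "bij f" "bij g"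
    using assms subgroup.subset[OF assms(1)] by (auto simp: carrier_U)
  then show ?thesis
    using subgroup.m_closed[OF assms] by (simp add: mult_U)
qed

lemma subgroup_U_id: "subgroup H U \<Longrightarrow> id \<in> H"
  using subgroup.one_closed[of H U] by simp

lemma inv_U:
  assumes "f \<in> carrier U"
  shows "inv\<^bsub>U\<^esub> f \<circ> f = id" "f \<circ> inv\<^bsub>U\<^esub> f = id"
proof -
  have "bij f" "bij (inv\<^bsub>U\<^esub> f)"
    using assms U.inv_closed[OF assms] by (simp_all add: carrier_U)
  then show "inv\<^bsub>U\<^esub> f \<circ> f = id" "f \<circ> inv\<^bsub>U\<^esub> f = id"
    using U.l_inv[OF assms] U.r_inv[OF assms] by (simp_all add: mult_U)
qed

lemma subgroup_U_inv:
  assumes "subgroup H U" "f \<in> H"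
  obtains f' where "f' \<in> H" "f' \<circ> f = id" "f \<circ> f' = id"
  using inv_U[OF subgroup.mem_carrier[OF assms]] subgroup.m_inv_closed[OF assms] that by blast

lemma subgroup_UI:
  assumes "H \<subseteq> K" "subgroup K U" "id \<in> H"
    and comp: "\<And>f g. f \<in> H \<Longrightarrow> g \<in> H \<Longrightarrow> f \<circ> g \<in> H"
    and inv: "\<And>f f'. f \<in> H \<Longrightarrow> f' \<in> K \<Longrightarrow> f' \<circ> f = id \<Longrightarrow> f \<circ> f' = id \<Longrightarrow> f' \<in> H"
  shows "subgroup H U"
proof (rule U.subgroupI)
  show HU: "H \<subseteq> carrier U"
    using assms(1) subgroup.subset[OF assms(2)] by (rule subset_trans)
  show "H \<noteq> {}"
    using assms(3) by blast
  fix f assume f: "f \<in> H"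
  then have fU: "f \<in> carrier U" and fK: "f \<in> K"
    using HU assms(1) by blast+
  show "inv\<^bsub>U\<^esub> f \<in> H"
    using f subgroup.m_inv_closed[OF assms(2) fK] inv_U[OF fU] by (rule inv)
  fix g assume g: "g \<in> H"
  then have "bij f" "bij g"
    using fU HU by (auto simp: carrier_U)
  then show "f \<otimes>\<^bsub>U\<^esub> g \<in> H"
    using comp[OF f g] by (simp add: mult_U)
qed

lemma involution_U:
  assumes "f \<circ> f = id"
  shows "f \<in> carrier U" "inv\<^bsub>U\<^esub> f = f"
proof -
  show f: "f \<in> carrier U"
    using assms by (simp add: carrier_U o_bij)
  then show "inv\<^bsub>U\<^esub> f = f"
    using assms by (intro U.inv_equality) (auto simp: carrier_U mult_U)
qed

lemma generate_U_subgroup: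
  assumes "\<forall>s \<in> S. s \<circ> s = id"
  shows "subgroup (generate U S) U"
  using assms involution_U by (intro U.generate_is_subgroup) blast

lemma generate_U_induct:
  assumes S: "\<forall>s \<in> S. s \<circ> s = id"
    and g: "g \<in> generate U S"
    and "P id"
    and comp: "\<And>s g. s \<in> S \<Longrightarrow> g \<in> generate U S \<Longrightarrow> P g \<Longrightarrow> P (s \<circ> g)"
  shows "P g"
proof -
  have SU: "S \<subseteq> carrier U" and inv: "\<forall>s \<in> S. inv\<^bsub>U\<^esub> s \<in> S"
    using S involution_U by auto
  show ?thesis
  proof (rule U.generate_left_induct[OF SU inv g])
    show "P \<one>\<^bsub>U\<^esub>"
      using assms(3) by simp
    fix s g assume s: "s \<in> S" and g: "g \<in> generate U S" "P g"
    then have "bij s" "bij g"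
      using SU U.generate_in_carrier[OF SU] by (auto simp: carrier_U)
    then show "P (s \<otimes>\<^bsub>U\<^esub> g)"
      using comp[OF s g] by (simp add: mult_U)
  qed
qed

section \<open>The first Grigorchuk group\<close>

lemma ga_ga [simp]: "ga (ga w) = w"
  by (cases w) auto

lemma gbcd_invol: "gb (gb w) = w \<and> gc (gc w) = w \<and> gd (gd w) = w"
proof (induction w)
  case (Cons x w)
  then show ?case by (cases x) auto
qed auto

lemma gb_gb [simp]: "gb (gb w) = w" and gc_gc [simp]: "gc (gc w) = w" and gd_gd [simp]: "gd (gd w) = w"
  using gbcd_invol by auto

text \<open>The six products need a simultaneous induction: below the letter 1 the product
  \<open>bc\<close> becomes \<open>cd\<close>, then \<open>db\<close>, and so on round the
  cycle.\<close>

lemma gbcd_mult: "gb (gc w) = gd w \<and> gc (gd w) = gb w \<and> gd (gb w) = gc w \<and>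
  gc (gb w) = gd w \<and> gd (gc w) = gb w \<and> gb (gd w) = gc w"
proof (induction w)
  case (Cons x w)
  then show ?case by (cases x) auto
qed auto

lemma gbcd_simps [simp]: "gb (gc w) = gd w" "gc (gd w) = gb w" "gd (gb w) = gc w"
  "gc (gb w) = gd w" "gd (gc w) = gb w" "gb (gd w) = gc w"
  using gbcd_mult by auto

abbreviation Gr :: "(bool list \<Rightarrow> bool list) set" where
  "Gr \<equiv> carrier Grig"

lemma Gr_eq: "Gr = generate U {ga, gb, gc, gd}"
  by (simp add: Grig_def)

lemma Gr_gens_invol: "\<forall>s \<in> {ga, gb, gc, gd}. s \<circ> s = id"
  by (auto simp: fun_eq_iff)

lemma Gr_subgroup: "subgroup Gr U"
  unfolding Gr_eq using Gr_gens_invol by (rule generate_U_subgroup)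

lemma Gr_induct [consumes 1, case_names id a b c d]:
  assumes "g \<in> Gr" "P id"
    and "\<And>g. g \<in> Gr \<Longrightarrow> P g \<Longrightarrow> P (ga \<circ> g)"
    and "\<And>g. g \<in> Gr \<Longrightarrow> P g \<Longrightarrow> P (gb \<circ> g)"
    and "\<And>g. g \<in> Gr \<Longrightarrow> P g \<Longrightarrow> P (gc \<circ> g)"
    and "\<And>g. g \<in> Gr \<Longrightarrow> P g \<Longrightarrow> P (gd \<circ> g)"
  shows "P g"
  using Gr_gens_invol assms(1)[unfolded Gr_eq]
proof (rule generate_U_induct)
  fix s g assume "s \<in> {ga, gb, gc, gd}" "g \<in> generate U {ga, gb, gc, gd}" "P g"
  then show "P (s \<circ> g)"
    using assms(3-6)[of g] by (elim insertE emptyE) (simp_all add: Gr_eq)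
qed (rule assms(2))

lemma Gr_gens [simp]: "ga \<in> Gr" "gb \<in> Gr" "gc \<in> Gr" "gd \<in> Gr"
  by (auto simp: Gr_eq intro: generate.incl)

lemma Gr_id [simp]: "id \<in> Gr"
  using subgroup_U_id[OF Gr_subgroup] .

lemma Gr_comp [simp]: "f \<in> Gr \<Longrightarrow> g \<in> Gr \<Longrightarrow> f \<circ> g \<in> Gr"
  using subgroup_U_comp[OF Gr_subgroup] .

lemma Gr_bij: "g \<in> Gr \<Longrightarrow> bij g"
  using subgroup.subset[OF Gr_subgroup] by (auto simp: carrier_U)

lemma Gr_length: "g \<in> Gr \<Longrightarrow> length (g w) = length w"
proof -
  have a: "length (ga w) = length w" for w
    by (cases w) auto
  have bcd: "length (gb w) = length w \<and> length (gc w) = length w \<and> length (gd w) = length w" for w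
  proof (induction w)
    case (Cons x w)
    then show ?case by (cases x) (auto simp: a)
  qed auto
  show "g \<in> Gr \<Longrightarrow> length (g w) = length w"
    by (induction arbitrary: w rule: Gr_induct) (auto simp: a bcd)
qed

text \<open>\<open>pr x y\<close> is the automorphism usually written as \<open>(x, y)\<close>: it fixes the two vertices of
  level 1 and acts on the subtrees below them as \<open>x\<close> and \<open>y\<close>.\<close>

fun pr :: "(bool list \<Rightarrow> bool list) \<Rightarrow> (bool list \<Rightarrow> bool list) \<Rightarrow> bool list \<Rightarrow> bool list" where
  "pr x y [] = []"
| "pr x y (False # w) = False # x w"
| "pr x y (True # w) = True # y w"

lemma pr_eq_iff: "f = pr x y \<longleftrightarrow>
    f [] = [] \<and> (\<forall>w. f (False # w) = False # x w) \<and> (\<forall>w. f (True # w) = True # y w)"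
  (is "_ \<longleftrightarrow> ?R")
proof
  assume R: ?R
  show "f = pr x y"
  proof
    fix w show "f w = pr x y w"
      by (cases "(x, y, w)" rule: pr.cases) (use R in auto)
  qed
qed auto

lemma pr_inject: "pr x y = pr x' y' \<longleftrightarrow> x = x' \<and> y = y'"
  by (auto simp: pr_eq_iff)

lemma pr_id: "pr id id = id"
  by (rule sym) (simp add: pr_eq_iff)

lemma pr_eq_id: "pr x y = id \<longleftrightarrow> x = id \<and> y = id"
  using pr_inject[of x y id id] by (simp only: pr_id)

lemma pr_comp: "pr x y \<circ> pr x' y' = pr (x \<circ> x') (y \<circ> y')"
  by (simp add: pr_eq_iff)

lemma pr_gens: "gb = pr ga gc" "gc = pr ga gd" "gd = pr id gb"
  by (simp_all add: pr_eq_iff)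

lemma conj_a_pr: "ga \<circ> pr x y \<circ> ga = pr y x"
  by (simp add: pr_eq_iff)

lemma ada_pr: "ga \<circ> gd \<circ> ga = pr gb id"
  using conj_a_pr[of id gb] by (simp only: pr_gens(3)[symmetric])

lemma pr_gb_id: "pr gb id \<in> Gr"
  unfolding ada_pr[symmetric] by (intro Gr_comp Gr_gens)

lemma a_comp_cancel [simp]: "ga \<circ> (ga \<circ> f) = f" "f \<circ> ga \<circ> ga = f"
  by (auto simp: fun_eq_iff)

section \<open>Decomposition over the two subtrees, sections and parities\<close>

lemma pr_comp_a: "pr x y \<circ> (ga \<circ> pr x' y') = ga \<circ> pr (y \<circ> x') (x \<circ> y')"
proof
  fix w show "(pr x y \<circ> (ga \<circ> pr x' y')) w = (ga \<circ> pr (y \<circ> x') (x \<circ> y')) w"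
    by (cases "(x, y, w)" rule: pr.cases) auto
qed

text \<open>The generators \<open>b\<close>, \<open>c\<close>, \<open>d\<close> are themselves pairs
  with coordinates in \<open>Gr\<close>, and moving a pair past \<open>a\<close> only interchanges
  its coordinates. Hence left multiplication by a generator preserves the normal form.\<close>

lemma Gr_decomp:
  assumes "g \<in> Gr"
  shows "\<exists>x \<in> Gr. \<exists>y \<in> Gr. g = pr x y \<or> g = ga \<circ> pr x y"
proof -
  define D where "D g \<longleftrightarrow> (\<exists>x \<in> Gr. \<exists>y \<in> Gr. g = pr x y \<or> g = ga \<circ> pr x y)" for g
  have DI: "D (pr x y)" "D (ga \<circ> pr x y)" if "x \<in> Gr" "y \<in> Gr" for x y
    using that by (auto simp: D_def)
  have a: "D (ga \<circ> g)" if "D g" for g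
    using that DI by (auto simp: D_def)
  have pr: "D (pr u w \<circ> g)" if uw: "u \<in> Gr" "w \<in> Gr" and Dg: "D g" for u w g
  proof -
    obtain x y where xy: "x \<in> Gr" "y \<in> Gr" "g = pr x y \<or> g = ga \<circ> pr x y"
      using Dg by (auto simp: D_def)
    then show ?thesis
      using uw DI by (auto simp: pr_comp pr_comp_a)
  qed
  have "D g"
    using assms
  proof (induction rule: Gr_induct)
    case id
    show ?case using DI(1)[OF Gr_id Gr_id] by (simp only: pr_id)
  next
    case (a g)
    show ?case using \<open>D g\<close> by (rule \<open>\<And>g. D g \<Longrightarrow> D (ga \<circ> g)\<close>)
  next
    case (b g)
    show ?case using pr[OF Gr_gens(1,3) \<open>D g\<close>] by (simp only: pr_gens(1)[symmetric])
  next
    case (c g)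
    show ?case using pr[OF Gr_gens(1,4) \<open>D g\<close>] by (simp only: pr_gens(2)[symmetric])
  next
    case (d g)
    show ?case using pr[OF Gr_id Gr_gens(2) \<open>D g\<close>] by (simp only: pr_gens(3)[symmetric])
  qed
  then show ?thesis
    by (simp add: D_def)
qed

text \<open>The section (state) of \<open>g\<close> at the level 1 vertex \<open>z\<close>. Since
  \<open>tl\<close> drops the first letter of the image whatever it is, elements swapping the two
  subtrees have sections too.\<close>

definition sec :: "bool \<Rightarrow> (bool list \<Rightarrow> bool list) \<Rightarrow> bool list \<Rightarrow> bool list" where
  "sec z g w = tl (g (z # w))"

lemma sec_simps [simp]: "sec False (pr x y) = x" "sec True (pr x y) = y"
  "sec False (ga \<circ> pr x y) = x" "sec True (ga \<circ> pr x y) = y"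
  by (auto simp: sec_def fun_eq_iff)

text \<open>\<open>lam0\<close>, \<open>lam1\<close>, \<open>lam2\<close> give the parity of the number of vertices of level 0, 1, 2 at which an
  automorphism swaps the two subtrees. On words in the generators they count the letters in
  \<open>{a}\<close>, \<open>{b, c}\<close>, \<open>{b, d}\<close> modulo 2.\<close>

definition lam0 :: "(bool list \<Rightarrow> bool list) \<Rightarrow> bool" where
  "lam0 g \<longleftrightarrow> g [False] = [True]"

lemma sec_gens: "sec False ga = id" "sec True ga = id" "sec False gb = ga" "sec True gb = gc"
  "sec False gc = ga" "sec True gc = gd" "sec False gd = id" "sec True gd = gb"
  "sec z id = id"
  by (auto simp: sec_def fun_eq_iff)

definition lam1 :: "(bool list \<Rightarrow> bool list) \<Rightarrow> bool" where
  "lam1 g \<longleftrightarrow> lam0 (sec False g) \<noteq> lam0 (sec True g)"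

definition lam2 :: "(bool list \<Rightarrow> bool list) \<Rightarrow> bool" where
  "lam2 g \<longleftrightarrow> lam1 (sec False g) \<noteq> lam1 (sec True g)"

lemma Gr_pr:
  assumes "g \<in> Gr" "\<not> lam0 g"
  shows "g = pr (sec False g) (sec True g)" "sec False g \<in> Gr" "sec True g \<in> Gr"
proof -
  obtain x y where xy: "x \<in> Gr" "y \<in> Gr" "g = pr x y \<or> g = ga \<circ> pr x y"
    using Gr_decomp[OF assms(1)] by blast
  have "x [] = []"
    using Gr_length[OF xy(1), of "[]"] by simp
  then have "g = pr x y"
    using xy(3) assms(2) by (auto simp: lam0_def)
  then show "g = pr (sec False g) (sec True g)" "sec False g \<in> Gr" "sec True g \<in> Gr"
    using xy by auto
qed

lemma Gr_a_pr:
  assumes "g \<in> Gr" "lam0 g"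
  shows "g = ga \<circ> pr (sec False g) (sec True g)" "sec False g \<in> Gr" "sec True g \<in> Gr"
proof -
  obtain x y where xy: "x \<in> Gr" "y \<in> Gr" "g = pr x y \<or> g = ga \<circ> pr x y"
    using Gr_decomp[OF assms(1)] by blast
  then have "g = ga \<circ> pr x y"
    using assms(2) by (auto simp: lam0_def)
  then show "g = ga \<circ> pr (sec False g) (sec True g)" "sec False g \<in> Gr" "sec True g \<in> Gr"
    using xy by auto
qed

lemma pr_in_Gr:
  assumes "pr x y \<in> Gr"
  shows "x \<in> Gr" "y \<in> Gr"
  using Gr_pr(2,3)[OF assms] by (auto simp: lam0_def)

lemma sec_in_Gr: "g \<in> Gr \<Longrightarrow> sec z g \<in> Gr"
  using Gr_pr(2,3) Gr_a_pr(2,3) by (cases z; cases "lam0 g") auto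

lemma lam0_comp:
  assumes "g \<in> Gr" "h \<in> Gr"
  shows "lam0 (g \<circ> h) \<longleftrightarrow> lam0 g \<noteq> lam0 h"
proof -
  obtain x y x' y' where *: "x \<in> Gr" "y \<in> Gr" "g = pr x y \<or> g = ga \<circ> pr x y"
    "x' \<in> Gr" "y' \<in> Gr" "h = pr x' y' \<or> h = ga \<circ> pr x' y'"
    using Gr_decomp[OF assms(1)] Gr_decomp[OF assms(2)] by blast
  have "x [] = []" "y [] = []" "x' [] = []" "y' [] = []"
    using * Gr_length[of _ "[]"] by auto
  then show ?thesis
    using *(3,6) by (auto simp: lam0_def)
qed

text \<open>First \<open>h\<close> moves the subtree at \<open>z\<close> to the one at
  \<open>z \<noteq> lam0 h\<close>, an exclusive or, and \<open>g\<close> then acts there.\<close>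

lemma sec_comp:
  assumes "g \<in> Gr" "h \<in> Gr"
  shows "sec z (g \<circ> h) = sec (z \<noteq> lam0 h) g \<circ> sec z h"
proof -
  obtain x' y' where *: "x' \<in> Gr" "y' \<in> Gr" "h = pr x' y' \<or> h = ga \<circ> pr x' y'"
    using Gr_decomp[OF assms(2)] by blast
  have "x' [] = []" "y' [] = []"
    using * Gr_length[of _ "[]"] by auto
  then show ?thesis
    using *(3) by (cases z) (auto simp: lam0_def sec_def fun_eq_iff)
qed

text \<open>If \<open>h\<close> swaps the subtrees, the sections of \<open>g\<close> are merely
  interchanged, which leaves their sum modulo 2 unchanged.\<close>

lemma lam1_comp:
  assumes "g \<in> Gr" "h \<in> Gr"
  shows "lam1 (g \<circ> h) \<longleftrightarrow> lam1 g \<noteq> lam1 h"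
  unfolding lam1_def sec_comp[OF assms] lam0_comp[OF sec_in_Gr[OF assms(1)] sec_in_Gr[OF assms(2)]]
  by (cases "lam0 h") auto

lemma lam2_comp:
  assumes "g \<in> Gr" "h \<in> Gr"
  shows "lam2 (g \<circ> h) \<longleftrightarrow> lam2 g \<noteq> lam2 h"
  unfolding lam2_def sec_comp[OF assms] lam1_comp[OF sec_in_Gr[OF assms(1)] sec_in_Gr[OF assms(2)]]
  by (cases "lam0 h") auto

lemma lam_gens: "lam0 ga" "\<not> lam0 gb" "\<not> lam0 gc" "\<not> lam0 gd" "\<not> lam0 id"
  "\<not> lam1 ga" "lam1 gb" "lam1 gc" "\<not> lam1 gd" "\<not> lam1 id"
  "\<not> lam2 ga" "lam2 gb" "\<not> lam2 gc" "lam2 gd" "\<not> lam2 id"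
  by (auto simp: lam2_def lam1_def sec_gens lam0_def)

section \<open>Lifting second coordinates, and transitivity on levels\<close>

lemma Gr_lift:
  assumes "y \<in> Gr"
  shows "\<exists>x. pr x y \<in> Gr"
proof -
  \<comment> \<open>The elements \<open>aca\<close>, \<open>d\<close>, \<open>b\<close>,
    \<open>c\<close> have second coordinates \<open>a\<close>, \<open>b\<close>, \<open>c\<close>,
    \<open>d\<close>, so all generators of \<open>Gr\<close> can be lifted.\<close>
  have aca: "pr gd ga \<in> Gr"
    using Gr_comp[OF Gr_comp[OF Gr_gens(1,3)] Gr_gens(1)]
    by (simp only: pr_gens(2) conj_a_pr)
  have step: "\<exists>x. pr x (w \<circ> y) \<in> Gr" if "pr u w \<in> Gr" "\<exists>x. pr x y \<in> Gr" for u w y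
    using that Gr_comp pr_comp by metis
  show ?thesis
    using assms
  proof (induction rule: Gr_induct)
    case id
    show ?case using Gr_id pr_id by metis
  next
    case (a g)
    then show ?case using step[OF aca] by blast
  next
    case (b g)
    then show ?case using step[OF Gr_gens(4)[unfolded pr_gens(3)]] by blast
  next
    case (c g)
    then show ?case using step[OF Gr_gens(2)[unfolded pr_gens(1)]] by blast
  next
    case (d g)
    then show ?case using step[OF Gr_gens(3)[unfolded pr_gens(2)]] by blast
  qed
qed

lemma Gr_transitive: "\<exists>g \<in> Gr. g v = replicate (length v) True"
proof (induction v)
  case Nil
  then show ?case by (auto intro: bexI[of _ id])
next
  case (Cons z w)
  then obtain h where h: "h \<in> Gr" "h w = replicate (length w) True"
    by blast
  then obtain x where x: "pr x h \<in> Gr"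
    using Gr_lift by blast
  show ?case
  proof (cases z)
    case True
    then show ?thesis
      using h x by (intro bexI[OF _ x]) auto
  next
    case False
    then show ?thesis
      using h x by (intro bexI[of _ "pr x h \<circ> ga"]) auto
  qed
qed

section \<open>The normal closure of \<open>b\<close>\<close>

abbreviation cj :: "(bool list \<Rightarrow> bool list) \<Rightarrow> (bool list \<Rightarrow> bool list) \<Rightarrow> bool list \<Rightarrow> bool list" where
  "cj s f \<equiv> s \<circ> f \<circ> s"

text \<open>The normal closure of \<open>b\<close>; the quotient is the dihedral group of order 8 generated by the
  images of \<open>a\<close> and \<open>d\<close>.\<close>

definition GB :: "(bool list \<Rightarrow> bool list) set" where
  "GB = generate U {gb, cj ga gb, cj gd (cj ga gb), cj ga (cj gd (cj ga gb))}"

lemma GB_gens_invol: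
  "\<forall>s \<in> {gb, cj ga gb, cj gd (cj ga gb), cj ga (cj gd (cj ga gb))}. s \<circ> s = id"
  by (auto simp: fun_eq_iff)

lemma GB_subgroup: "subgroup GB U"
  unfolding GB_def using GB_gens_invol by (rule generate_U_subgroup)

lemma GB_gens: "gb \<in> GB" "cj ga gb \<in> GB" "cj gd (cj ga gb) \<in> GB"
  "cj ga (cj gd (cj ga gb)) \<in> GB"
  by (auto simp: GB_def intro: generate.incl)

lemmas GB_comp = subgroup_U_comp[OF GB_subgroup]

lemma GB_induct [consumes 1, case_names id comp]:
  assumes "g \<in> GB" "P id"
    and "\<And>s g. s \<in> {gb, cj ga gb, cj gd (cj ga gb), cj ga (cj gd (cj ga gb))} \<Longrightarrow>
      g \<in> GB \<Longrightarrow> P g \<Longrightarrow> P (s \<circ> g)"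
  shows "P g"
  using GB_gens_invol assms(1)[unfolded GB_def]
proof (rule generate_U_induct)
  fix s g assume "s \<in> {gb, cj ga gb, cj gd (cj ga gb), cj ga (cj gd (cj ga gb))}"
    "g \<in> generate U {gb, cj ga gb, cj gd (cj ga gb), cj ga (cj gd (cj ga gb))}" "P g"
  then show "P (s \<circ> g)"
    unfolding GB_def[symmetric] by (rule assms(3))
qed (rule assms(2))

text \<open>Conjugation by an involution is a homomorphism, so its values on the generators of
  \<open>GB\<close> decide.\<close>

lemma GB_cnj:
  assumes s: "s \<circ> s = id" and g: "g \<in> GB"
    and gens: "\<And>t. t \<in> {gb, cj ga gb, cj gd (cj ga gb), cj ga (cj gd (cj ga gb))} \<Longrightarrow> cj s t \<in> GB"
  shows "cj s g \<in> GB"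
  using g
proof (induction rule: GB_induct)
  case id
  show ?case using subgroup_U_id[OF GB_subgroup] by (simp only: comp_id s)
next
  case (comp t g)
  have "s (s w) = w" for w
    using s by (metis comp_apply id_apply)
  then have "cj s (t \<circ> g) = cj s t \<circ> cj s g"
    by (simp add: fun_eq_iff)
  then have "cj s (t \<circ> g) \<in> GB"
    using GB_comp[OF gens[OF comp(1)] comp(3)] by (simp only:)
  then show ?case .
qed

lemma GB_cnj_a: "g \<in> GB \<Longrightarrow> cj ga g \<in> GB"
proof (rule GB_cnj)
  fix t assume "t \<in> {gb, cj ga gb, cj gd (cj ga gb), cj ga (cj gd (cj ga gb))}"
  moreover have "cj ga (cj ga f) = f" for f
    by (simp add: fun_eq_iff)
  ultimately show "cj ga t \<in> GB"
    using GB_gens by auto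
qed (auto simp: fun_eq_iff)

lemma GB_cnj_d: "g \<in> GB \<Longrightarrow> cj gd g \<in> GB"
proof (rule GB_cnj)
  fix t assume t: "t \<in> {gb, cj ga gb, cj gd (cj ga gb), cj ga (cj gd (cj ga gb))}"
  have "cj gd gb = gb" "cj gd (cj gd f) = f" for f
    by (simp_all add: fun_eq_iff)
  \<comment> \<open>Here \<open>adabada = (bab, c)\<close> commutes with \<open>d = (1, b)\<close>
    because \<open>b\<close> and \<open>c\<close> commute. The rule \<open>pr.cases\<close> supplies
    the case split on the first letter of \<open>w\<close>.\<close>
  moreover have "cj gd (cj ga (cj gd (cj ga gb))) = cj ga (cj gd (cj ga gb))"
  proof
    fix w show "cj gd (cj ga (cj gd (cj ga gb))) w = cj ga (cj gd (cj ga gb)) w"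
      by (cases "(gb, gb, w)" rule: pr.cases) auto
  qed
  ultimately show "cj gd t \<in> GB"
    using t GB_gens by (elim insertE) simp_all
qed (auto simp: fun_eq_iff)

text \<open>These conditions separate \<open>GB\<close> from its other cosets: \<open>lam0\<close>
  and \<open>lam1 + lam2\<close> count the letters \<open>a\<close> and those in
  \<open>{c, d}\<close> modulo 2, and the last equation excludes \<open>adad = (b, b)\<close>, which
  both counts miss.\<close>

lemma GB_invariants:
  assumes "g \<in> GB"
  shows "g \<in> Gr \<and> \<not> lam0 g \<and> lam1 g = lam2 g \<and> lam1 (sec False g) = lam0 (sec True g)"
  using assms
proof (induction rule: GB_induct)
  case id
  have "id \<in> Gr \<and> \<not> lam0 id \<and> lam1 id = lam2 id \<and> lam1 (sec False id) = lam0 (sec True id)"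
    by (simp add: lam_gens sec_gens)
  then show ?case .
next
  case (comp s g)
  then have "s \<in> Gr \<and> \<not> lam0 s \<and> lam1 s = lam2 s \<and> lam1 (sec False s) = lam0 (sec True s)"
    by (auto simp: lam0_comp lam1_comp lam2_comp sec_comp lam_gens sec_gens)
  with comp(3) have "s \<circ> g \<in> Gr \<and> \<not> lam0 (s \<circ> g) \<and> lam1 (s \<circ> g) = lam2 (s \<circ> g) \<and>
      lam1 (sec False (s \<circ> g)) = lam0 (sec True (s \<circ> g))"
    by (simp add: lam0_comp lam1_comp lam2_comp sec_comp sec_in_Gr)
  then show ?case .
qed

text \<open>The graph of the automorphism of \<open>Gr/GB\<close> that interchanges the classes of \<open>a\<close> and \<open>d\<close>,
  in terms of coset representatives.\<close>

definition swp :: "((bool list \<Rightarrow> bool list) \<times> (bool list \<Rightarrow> bool list)) set" where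
  "swp = {(id, id), (ga, gd), (gd, ga), (ga \<circ> gd, gd \<circ> ga), (gd \<circ> ga, ga \<circ> gd),
     (ga \<circ> (gd \<circ> ga), gd \<circ> (ga \<circ> gd)), (gd \<circ> (ga \<circ> gd), ga \<circ> (gd \<circ> ga)),
     (ga \<circ> (gd \<circ> (ga \<circ> gd)), ga \<circ> (gd \<circ> (ga \<circ> gd)))}"

text \<open>The relations of the dihedral group of order 8, oriented as rewrite rules that lead to
  the eight representatives in \<open>swp\<close>.\<close>

lemma dihedral: "ga \<circ> ga = id" "gd \<circ> gd = id"
  "gd \<circ> (ga \<circ> (gd \<circ> ga)) = ga \<circ> (gd \<circ> (ga \<circ> gd))"
  "ga \<circ> (gd \<circ> (ga \<circ> (gd \<circ> ga))) = gd \<circ> (ga \<circ> gd)"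
proof -
  show "ga \<circ> ga = id" "gd \<circ> gd = id"
    by (simp_all add: fun_eq_iff)
  show *: "gd \<circ> (ga \<circ> (gd \<circ> ga)) = ga \<circ> (gd \<circ> (ga \<circ> gd))"
  proof
    fix w show "(gd \<circ> (ga \<circ> (gd \<circ> ga))) w = (ga \<circ> (gd \<circ> (ga \<circ> gd))) w"
      by (cases "(gb, gb, w)" rule: pr.cases) auto
  qed
  show "ga \<circ> (gd \<circ> (ga \<circ> (gd \<circ> ga))) = gd \<circ> (ga \<circ> gd)"
    by (simp add: *)
qed

lemma swp_a_d:
  assumes "(p, q) \<in> swp"
  shows "(p \<circ> ga, q \<circ> gd) \<in> swp" "(p \<circ> gd, q \<circ> ga) \<in> swp"
  using assms unfolding swp_def by (elim insertE emptyE; simp add: comp_assoc dihedral)+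

lemma swp_GB:
  assumes "(p, q) \<in> swp" "q \<in> GB"
  shows "p = id"
proof -
  have "\<not> lam0 q" "lam1 q = lam2 q" "lam1 (sec False q) = lam0 (sec True q)"
    using GB_invariants[OF assms(2)] by auto
  then show ?thesis
    using assms(1) unfolding swp_def
    by (elim insertE emptyE) (simp_all add: lam0_comp lam1_comp lam2_comp sec_comp lam_gens sec_gens)
qed

text \<open>Modulo \<open>GB\<close>, where \<open>b\<close> vanishes and \<open>c = bd\<close>
  becomes \<open>d\<close>, the generators have sections \<open>a: (1, 1)\<close>,
  \<open>b: (a, d)\<close>, \<open>c: (a, d)\<close>, \<open>d: (1, 1)\<close>. So the classes of
  the two sections always correspond under interchanging \<open>a\<close> and \<open>d\<close>;
  \<open>p\<close> and \<open>q\<close> represent their inverses.\<close>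

lemma sec_swp:
  assumes "g \<in> Gr"
  shows "\<exists>(p, q) \<in> swp. sec False g \<circ> p \<in> GB \<and> sec True g \<circ> q \<in> GB"
proof -
  define R where "R = (\<lambda>x y. \<exists>(p, q) \<in> swp. x \<circ> p \<in> GB \<and> y \<circ> q \<in> GB)"
  have ad: "R (ga \<circ> x) (gd \<circ> y)" "R (gd \<circ> x) (ga \<circ> y)" if xy: "R x y" for x y
  proof -
    obtain p q where pq: "(p, q) \<in> swp" "x \<circ> p \<in> GB" "y \<circ> q \<in> GB"
      using xy by (auto simp: R_def)
    show "R (ga \<circ> x) (gd \<circ> y)"
      unfolding R_def using swp_a_d(1)[OF pq(1)] GB_cnj_a[OF pq(2)] GB_cnj_d[OF pq(3)]
      by (intro bexI[of _ "(p \<circ> ga, q \<circ> gd)"]) (simp_all add: comp_assoc)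
    show "R (gd \<circ> x) (ga \<circ> y)"
      unfolding R_def using swp_a_d(2)[OF pq(1)] GB_cnj_d[OF pq(2)] GB_cnj_a[OF pq(3)]
      by (intro bexI[of _ "(p \<circ> gd, q \<circ> ga)"]) (simp_all add: comp_assoc)
  qed
  have b_left: "R (gb \<circ> x) y" and b_right: "R x (gb \<circ> y)" if "R x y" for x y
    using that GB_comp[OF GB_gens(1)] by (fastforce simp: R_def comp_assoc)+
  have c: "gc = gb \<circ> gd"
    by (simp add: fun_eq_iff)
  have "R (sec False g) (sec True g)"
    using assms
  proof (induction rule: Gr_induct)
    case id
    have "R id id"
      unfolding R_def using subgroup_U_id[OF GB_subgroup]
      by (intro bexI[of _ "(id, id)"]) (auto simp: swp_def)
    then show ?case by (simp only: sec_gens)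
  next
    case (a g)
    then have "R (sec False (ga \<circ> g)) (sec True (ga \<circ> g))"
      by (cases "lam0 g") (simp_all add: sec_comp sec_gens)
    then show ?case .
  next
    case (b g)
    then have "R (sec False (gb \<circ> g)) (sec True (gb \<circ> g))"
      by (cases "lam0 g") (simp_all add: sec_comp sec_gens c comp_assoc b_left b_right ad)
    then show ?case .
  next
    case (c g)
    then have "R (sec False (gc \<circ> g)) (sec True (gc \<circ> g))"
      by (cases "lam0 g") (simp_all add: sec_comp sec_gens ad)
    then show ?case .
  next
    case (d g)
    then have "R (sec False (gd \<circ> g)) (sec True (gd \<circ> g))"
      by (cases "lam0 g") (simp_all add: sec_comp sec_gens b_left b_right)
    then show ?case .
  qed
  then show ?thesis
    by (simp add: R_def)
qed

text \<open>With trivial second section, \<open>q\<close> itself lies in \<open>GB\<close>, which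
  forces \<open>p = id\<close>.\<close>

lemma pr_id_GB:
  assumes "pr x id \<in> Gr"
  shows "x \<in> GB"
proof -
  obtain p q where pq: "(p, q) \<in> swp" "x \<circ> p \<in> GB" "q \<in> GB"
    using sec_swp[OF assms] by auto
  then show ?thesis
    using swp_GB[OF pq(1,3)] by simp
qed

text \<open>Starting from \<open>ada = (b, 1)\<close>, conjugation by \<open>c = (a, d)\<close> and
  by \<open>(dad, ada)\<close> conjugates the first coordinate by \<open>a\<close> and by
  \<open>dad\<close> and keeps the second trivial. This reaches all four generators of
  \<open>GB\<close>.\<close>

lemma GB_pr_id:
  assumes Q: "subgroup Q U" "cj ga gd \<in> Q" "gc \<in> Q" "pr (cj gd ga) (cj ga gd) \<in> Q"
    and x: "x \<in> GB"
  shows "pr x id \<in> Q"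
  using x
proof (induction rule: GB_induct)
  case id
  show ?case using subgroup_U_id[OF Q(1)] by (simp only: pr_id)
next
  case (comp s g)
  note Qc = subgroup_U_comp[OF Q(1)]
  have 1: "pr gb id \<in> Q"
    using Q(2) by (simp only: ada_pr)
  have c: "pr (cj ga x) id \<in> Q" if "pr x id \<in> Q" for x
  proof -
    have "cj gc (pr x id) = pr (cj ga x) id"
      by (simp add: pr_eq_iff)
    then show ?thesis
      using Qc[OF Qc[OF Q(3) that] Q(3)] by simp
  qed
  \<comment> \<open>Since \<open>d\<close> commutes with \<open>b\<close>, conjugating
    \<open>b\<close> by \<open>dad\<close> gives \<open>dabad\<close>.\<close>
  have e: "cj (pr (cj gd ga) (cj ga gd)) (pr gb id) = pr (cj gd (cj ga gb)) id"
    by (simp add: pr_eq_iff)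
  have 2: "pr (cj gd (cj ga gb)) id \<in> Q"
    using Qc[OF Qc[OF Q(4) 1] Q(4)] unfolding e .
  have "pr s id \<in> Q"
    using comp(1) 1 2 c[OF 1] c[OF 2] by auto
  then show ?case
    using Qc[OF _ comp(3)] by (metis pr_comp comp_id)
qed

text \<open>Two pairs in \<open>Gr\<close> with equal second coordinates differ by some
  \<open>(z, 1)\<close> in \<open>Gr\<close>, and \<open>Q\<close> contains all of these.\<close>

lemma pr_in_subgroup:
  assumes Q: "subgroup Q U" "cj ga gd \<in> Q" "gc \<in> Q" "pr (cj gd ga) (cj ga gd) \<in> Q"
    and "Q \<subseteq> Gr" "pr x' y \<in> Q" "pr x y \<in> Gr"
  shows "pr x y \<in> Q"
proof -
  obtain q where q: "q \<in> Q" "q \<circ> pr x' y = id" "pr x' y \<circ> q = id"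
    using subgroup_U_inv[OF Q(1) assms(6)] .
  have "\<not> lam0 q"
    using q assms(5,6) lam0_comp[of q "pr x' y"] lam_gens(5) by (auto simp: lam0_def)
  then obtain u w where uw: "q = pr u w"
    using Gr_pr(1) q(1) assms(5) by blast
  have yw: "y \<circ> w = id" "u \<circ> x' = id"
    using q(2,3) by (simp_all add: uw pr_comp pr_eq_id)
  have "pr x y \<circ> q \<in> Gr"
    using q(1) assms(5,7) by auto
  then have "pr (x \<circ> u) id \<in> Gr"
    by (simp add: uw pr_comp yw)
  then have "pr (x \<circ> u) id \<circ> pr x' y \<in> Q"
    using subgroup_U_comp[OF Q(1) GB_pr_id[OF Q pr_id_GB] assms(6)] by blast
  then show ?thesis
    by (simp add: pr_comp comp_assoc yw)
qed

section \<open>Generators of the stabilizers\<close>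

lemma st_subgroup: "subgroup (st v) U"
proof (rule subgroup_UI[OF _ Gr_subgroup])
  fix f f' assume "f \<in> st v" "f' \<in> Gr" "f' \<circ> f = id"
  then show "f' \<in> st v"
    by (metis (mono_tags, lifting) st_def comp_apply id_apply mem_Collect_eq)
qed (auto simp: st_def)

lemma st_Suc: "g \<in> st (replicate (Suc n) True) \<longleftrightarrow>
    g \<in> Gr \<and> (\<exists>x y. g = pr x y \<and> y \<in> st (replicate n True))"
proof
  assume g: "g \<in> st (replicate (Suc n) True)"
  then have gG: "g \<in> Gr" "g (True # replicate n True) = True # replicate n True"
    by (auto simp: st_def)
  have "\<not> lam0 g"
  proof
    assume "lam0 g"
    then have "hd (g (True # replicate n True)) = False"
      using Gr_a_pr(1)[OF gG(1)] by (metis comp_apply ga.simps(2) pr.simps(3) list.sel(1))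
    then show False
      using gG(2) by simp
  qed
  then show "g \<in> Gr \<and> (\<exists>x y. g = pr x y \<and> y \<in> st (replicate n True))"
    using Gr_pr[OF gG(1)] gG
    by (smt (verit) pr.simps(3) list.inject mem_Collect_eq st_def)
qed (auto simp: st_def)

text \<open>The conditions on \<open>x0\<close>, \<open>x1\<close>, \<open>x2\<close> carry the
  induction: lifts of these three elements provide \<open>c\<close> and \<open>(dad, ada)\<close>,
  as \<open>GB_pr_id\<close> demands. In each step \<open>ada\<close> becomes the new
  \<open>x0\<close> and the lift of the old one joins \<open>R\<close>, so \<open>R\<close> grows by
  at most one element.\<close>

lemma st_generators:
  "\<exists>x0 x1 x2 R. finite R \<and> card R \<le> n \<and> {x0, x1, x2} \<union> R \<subseteq> st (replicate n True) \<and>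
     generate U ({x0, x1, x2} \<union> R) = st (replicate n True) \<and>
     x0 \<in> {ga, cj ga gd} \<and> (x1, x2) \<in> {(gb, gc), (gc, gd), (gd, gb)}"
proof (induction n)
  case 0
  have G: "st (replicate 0 True) = Gr"
    using Gr_length[of _ "[]"] by (auto simp: st_def)
  let ?H = "generate U {ga, gb, gc}"
  have sub: "{ga, gb, gc} \<subseteq> Gr"
    by auto
  have H: "subgroup ?H U"
    using generate_U_subgroup[of "{ga, gb, gc}"] Gr_gens_invol by auto
  have "gb \<circ> gc \<in> ?H"
    by (intro subgroup_U_comp[OF H]) (auto intro: generate.incl)
  moreover have "gb \<circ> gc = gd"
    by (simp add: fun_eq_iff)
  ultimately have "{ga, gb, gc, gd} \<subseteq> ?H"
    by (auto intro: generate.incl)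
  then have "Gr \<subseteq> ?H"
    unfolding Gr_eq using U.generate_subgroup_incl H by blast
  then have HG: "?H = Gr"
    using U.generate_subgroup_incl[OF sub Gr_subgroup] by blast
  show ?case
    unfolding G
    by (rule exI[of _ ga], rule exI[of _ gb], rule exI[of _ gc], rule exI[of _ "{}"]) (simp add: HG)
next
  case (Suc n)
  let ?P = "st (replicate n True)" and ?P' = "st (replicate (Suc n) True)"
  let ?bcd = "{(gb, gc), (gc, gd), (gd, gb)}"
  obtain x0 x1 x2 R where R: "finite R" "card R \<le> n" "{x0, x1, x2} \<union> R \<subseteq> ?P"
    "generate U ({x0, x1, x2} \<union> R) = ?P" "x0 \<in> {ga, cj ga gd}" "(x1, x2) \<in> ?bcd"
    using Suc.IH by blast
  define L where "L y = pr (SOME x. pr x y \<in> Gr) y" for y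
  have L: "L y \<in> Gr" if "y \<in> Gr" for y
    unfolding L_def using someI_ex[OF Gr_lift[OF that]] .
  \<comment> \<open>Explicit lifts: \<open>aca = (d, a)\<close> for \<open>a\<close>, and
    \<open>(dad, ada)\<close>, the conjugate of \<open>c\<close> by \<open>aca\<close>, for
    \<open>ada\<close>.\<close>
  define y0 where "y0 = pr (if x0 = ga then gd else cj gd ga) x0"
  \<comment> \<open>As \<open>b\<close>, \<open>c\<close>, \<open>d\<close> are second coordinates
    of \<open>d\<close>, \<open>b\<close>, \<open>c\<close>, lifting moves the pair one step round
    the cycle.\<close>
  obtain y1 y2 u1 u2 where y12: "(y1, y2) \<in> ?bcd" "y1 = pr u1 x1" "y2 = pr u2 x2"
  proof -
    consider "x1 = gb" "x2 = gc" | "x1 = gc" "x2 = gd" | "x1 = gd" "x2 = gb"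
      using R(6) by blast
    then show ?thesis
    proof cases
      case 1
      then show ?thesis by (intro that[of gd gb id ga]) (simp_all flip: pr_gens)
    next
      case 2
      then show ?thesis by (intro that[of gb gc ga ga]) (simp_all flip: pr_gens)
    next
      case 3
      then show ?thesis by (intro that[of gc gd ga id]) (simp_all flip: pr_gens)
    qed
  qed
  have aca: "cj ga gc = pr gd ga"
    by (simp add: pr_gens(2) conj_a_pr)
  have eq: "pr gd ga \<circ> gc \<circ> pr gd ga = pr (cj gd ga) (cj ga gd)"
    by (simp add: pr_eq_iff)
  have acaG: "pr gd ga \<in> Gr"
    by (simp flip: aca)
  have y0G: "y0 \<in> Gr"
    using R(5) acaG Gr_comp[OF Gr_comp[OF acaG Gr_gens(3)] acaG] unfolding eq by (auto simp: y0_def)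
  let ?z = "cj ga gd"
  let ?R = "insert y0 (L ` R)"
  let ?S = "{?z, y1, y2} \<union> ?R"
  have SP: "?S \<subseteq> ?P'"
  proof -
    have "?z \<in> ?P'"
      unfolding st_Suc ada_pr using pr_gb_id subgroup_U_id[OF st_subgroup] by blast
    moreover have "y1 \<in> ?P'" "y2 \<in> ?P'"
      using y12 R(3) by (auto simp: st_Suc simp del: replicate_Suc)
    moreover have "y0 \<in> ?P'"
      using y0G R(3) by (auto simp: st_Suc y0_def simp del: replicate_Suc)
    moreover have "L r \<in> ?P'" if "r \<in> R" for r
    proof -
      have "r \<in> ?P" "r \<in> Gr"
        using that R(3) by (auto simp: st_def)
      then show ?thesis
        using L[of r] by (auto simp: st_Suc L_def simp del: replicate_Suc)
    qed
    ultimately show ?thesis by blast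
  qed
  define Q where "Q = generate U ?S"
  have "?S \<subseteq> carrier U"
    using SP subgroup.subset[OF st_subgroup] by blast
  then have Q: "subgroup Q U"
    unfolding Q_def by (rule U.generate_is_subgroup)
  have QP: "Q \<subseteq> ?P'"
    unfolding Q_def using SP st_subgroup by (rule U.generate_subgroup_incl)
  then have QG: "Q \<subseteq> Gr"
    by (auto simp: st_def)
  have SQ: "?S \<subseteq> Q"
    by (auto simp: Q_def intro: generate.incl)
  note Qc = subgroup_U_comp[OF Q]
  have zQ: "?z \<in> Q"
    using SQ by blast
  \<comment> \<open>Any two of \<open>b\<close>, \<open>c\<close>, \<open>d\<close> generate
    \<open>c\<close>; for the pair \<open>(d, b)\<close> it is their product.\<close>
  have cQ: "gc \<in> Q"
  proof -
    have "y1 \<in> Q" "y2 \<in> Q"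
      using SQ by auto
    then show ?thesis
      using y12(1) Qc[of gd gb] by (auto simp: comp_def)
  qed
  have eQ: "pr (cj gd ga) (cj ga gd) \<in> Q"
  proof -
    have y0: "y0 \<in> Q"
      using SQ by blast
    show ?thesis
    proof (cases "x0 = ga")
      case True
      then have "pr gd ga \<in> Q"
        using y0 by (simp add: y0_def)
      then show ?thesis
        using Qc[OF Qc[OF _ cQ]] eq by metis
    next
      case False
      then show ?thesis
        using y0 R(5) by (auto simp: y0_def)
    qed
  qed
  \<comment> \<open>The second coordinates of pairs in \<open>Q\<close> form a subgroup containing
    generators of \<open>?P\<close>, so \<open>Q\<close> projects onto \<open>?P\<close>.\<close>
  have PQ: "?P \<subseteq> {y. \<exists>x. pr x y \<in> Q}"
  proof -
    have "subgroup {y. \<exists>x. pr x y \<in> Q} U"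
    proof (rule subgroup_UI[OF _ Gr_subgroup])
      show "{y. \<exists>x. pr x y \<in> Q} \<subseteq> Gr"
        using QG pr_in_Gr by blast
      have "pr id id \<in> Q"
        unfolding pr_id using Q by (rule subgroup_U_id)
      then show "id \<in> {y. \<exists>x. pr x y \<in> Q}"
        by blast
      fix f assume "f \<in> {y. \<exists>x. pr x y \<in> Q}"
      then obtain x where x: "pr x f \<in> Q" by blast
      show "f \<circ> g \<in> {y. \<exists>x. pr x y \<in> Q}" if "g \<in> {y. \<exists>x. pr x y \<in> Q}" for g
      proof -
        obtain x' where "pr x' g \<in> Q"
          using \<open>g \<in> _\<close> by blast
        then have "pr (x \<circ> x') (f \<circ> g) \<in> Q"
          using Qc[OF x] by (simp only: pr_comp[symmetric])
        then show ?thesis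
          by blast
      qed
      fix f' assume f': "f' \<circ> f = id" "f \<circ> f' = id"
      obtain q where q: "q \<in> Q" "q \<circ> pr x f = id"
        using subgroup_U_inv[OF Q x] by metis
      obtain u w where uw: "q = pr u w"
        using q(1) QP st_Suc by blast
      have "w \<circ> f = id"
        using q(2) by (simp add: uw pr_comp pr_eq_id)
      then have "w = f'"
        using f'(2) by (metis comp_assoc comp_id id_comp)
      then show "f' \<in> {y. \<exists>x. pr x y \<in> Q}"
        using q(1) uw by blast
    qed
    moreover have "{x0, x1, x2} \<union> R \<subseteq> {y. \<exists>x. pr x y \<in> Q}"
      using SQ y12(2,3) unfolding y0_def L_def by blast
    ultimately show ?thesis
      using U.generate_subgroup_incl R(4) by blast
  qed
  have "?P' \<subseteq> Q"
  proof
    fix g assume "g \<in> ?P'"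
    then obtain x y where g: "g = pr x y" "y \<in> ?P" "pr x y \<in> Gr"
      unfolding st_Suc by blast
    then obtain x' where "pr x' y \<in> Q"
      using PQ by blast
    then show "g \<in> Q"
      unfolding g(1) using g(3) by (rule pr_in_subgroup[OF Q zQ cQ eQ QG])
  qed
  then have "generate U ?S = ?P'"
    using QP Q_def by blast
  moreover have "card ?R \<le> Suc n"
    using card_image_le[OF R(1), of L] R(1,2) by (simp add: card_insert_if)
  ultimately have gens: "finite ?R \<and> card ?R \<le> Suc n \<and> ?S \<subseteq> ?P' \<and> generate U ?S = ?P' \<and>
      ?z \<in> {ga, ?z} \<and> (y1, y2) \<in> ?bcd"
    using SP y12(1) R(1) by blast
  show ?case
    by (rule exI[of _ ?z], rule exI[of _ y1], rule exI[of _ y2], rule exI[of _ ?R]) (rule gens)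
qed

section \<open>Homomorphisms onto elementary abelian 2-groups\<close>

text \<open>A vector over \<open>Z/2\<close> encoded as the set of its nonzero positions: 0, 1, 2
  for the parities of the section reached at the end of the path of ones, and \<open>n + 3\<close>
  for the parity added in passing from level \<open>n\<close> to \<open>n + 1\<close>.\<close>

fun chi :: "nat \<Rightarrow> (bool list \<Rightarrow> bool list) \<Rightarrow> nat set" where
  "chi 0 g = {k. k = 0 \<and> lam0 g \<or> k = 1 \<and> lam1 g \<or> k = 2 \<and> lam2 g}"
| "chi (Suc n) g = chi n (sec True g) \<union> {k. k = n + 3 \<and> lam1 (sec False g)}"

lemma chi_subset: "chi n g \<subseteq> {..<n + 3}"
proof (induction n arbitrary: g)
  case (Suc n)
  show ?case
    using Suc[of "sec True g"] by auto
qed auto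

lemma chi_comp:
  assumes "g \<in> st (replicate n True)" "h \<in> st (replicate n True)"
  shows "chi n (g \<circ> h) = sym_diff (chi n g) (chi n h)"
  using assms
proof (induction n arbitrary: g h)
  case 0
  then have gh: "g \<in> Gr" "h \<in> Gr"
    by (auto simp: st_def)
  have "chi 0 (g \<circ> h) = sym_diff (chi 0 g) (chi 0 h)"
    unfolding chi.simps lam0_comp[OF gh] lam1_comp[OF gh] lam2_comp[OF gh] by auto
  then show ?case .
next
  case (Suc n)
  obtain x y x' y' where *: "g = pr x y" "y \<in> st (replicate n True)"
    "h = pr x' y'" "y' \<in> st (replicate n True)" "g \<in> Gr" "h \<in> Gr"
    using Suc.prems unfolding st_Suc by blast
  then have x: "x \<in> Gr" "x' \<in> Gr"
    using pr_in_Gr(1)[of x y] pr_in_Gr(1)[of x' y'] by simp_all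
  \<comment> \<open>The new position is disjoint from the old ones, so the symmetric difference can
    be taken separately.\<close>
  have "n + 3 \<notin> chi n y" "n + 3 \<notin> chi n y'"
    using chi_subset[of n y] chi_subset[of n y'] by auto
  then have eq: "sym_diff (chi n y) (chi n y') \<union> {k. k = n + 3 \<and> lam1 x \<noteq> lam1 x'} =
      sym_diff (chi (Suc n) g) (chi (Suc n) h)"
    unfolding *(1,3) chi.simps sec_simps by blast
  have "chi (Suc n) (g \<circ> h) =
      sym_diff (chi n y) (chi n y') \<union> {k. k = n + 3 \<and> lam1 x \<noteq> lam1 x'}"
    by (simp only: *(1,3) pr_comp chi.simps sec_simps Suc.IH[OF *(2,4)] lam1_comp[OF x])
  then show ?case
    unfolding eq .
qed

lemma chi_surj:
  assumes "A \<subseteq> {..<n + 3}"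
  shows "\<exists>g \<in> st (replicate n True). chi n g = A"
  using assms
proof (induction n arbitrary: A)
  case 0
  \<comment> \<open>The elements \<open>a\<close>, \<open>c\<close>, \<open>d\<close> have the unit
    vectors as values of \<open>lam0\<close>, \<open>lam1\<close>, \<open>lam2\<close>.\<close>
  let ?g = "(if 0 \<in> A then ga else id) \<circ> ((if 1 \<in> A then gc else id) \<circ> (if 2 \<in> A then gd else id))"
  have gG: "?g \<in> Gr"
    by (intro Gr_comp) simp_all
  have "chi 0 ?g = {k. k = 0 \<and> 0 \<in> A \<or> k = 1 \<and> 1 \<in> A \<or> k = 2 \<and> 2 \<in> A}"
    by (simp add: lam0_comp lam1_comp lam2_comp lam_gens)
  also have "\<dots> = A"
  proof -
    have "k = 0 \<or> k = 1 \<or> k = 2" if "k \<in> A" for k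
      using subsetD[OF 0 that] by (simp only: lessThan_iff) presburger
    then show ?thesis by blast
  qed
  finally have "chi 0 ?g = A" .
  moreover have "?g \<in> st (replicate 0 True)"
    using gG Gr_length[OF gG, of "[]"] by (simp only: st_def) simp
  ultimately show ?case
    by (rule bexI)
next
  case (Suc n)
  have "A - {n + 3} \<subseteq> {..<n + 3}"
  proof
    fix k assume "k \<in> A - {n + 3}"
    then show "k \<in> {..<n + 3}"
      using subsetD[OF Suc.prems, of k] by simp
  qed
  then obtain y where y: "y \<in> st (replicate n True)" "chi n y = A - {n + 3}"
    using Suc.IH by blast
  then obtain x where x: "pr x y \<in> Gr"
    using Gr_lift by (auto simp: st_def)
  show ?case
  proof (cases "lam1 x \<longleftrightarrow> n + 3 \<in> A")
    case True
    then show ?thesis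
      using x y by (intro bexI[of _ "pr x y"]) (auto simp: st_Suc simp del: replicate_Suc)
  next
    case False
    \<comment> \<open>Multiplication by \<open>ada = (b, 1)\<close> flips the new parity and leaves
      \<open>y\<close> unchanged.\<close>
    have "pr (gb \<circ> x) y \<in> Gr"
      using Gr_comp[OF pr_gb_id x] by (simp add: pr_comp)
    moreover have "lam1 (gb \<circ> x) \<longleftrightarrow> n + 3 \<in> A"
      using False pr_in_Gr(1)[OF x] by (simp add: lam1_comp lam_gens)
    ultimately show ?thesis
      using y by (intro bexI[of _ "pr (gb \<circ> x) y"]) (auto simp: st_Suc simp del: replicate_Suc)
  qed
qed

section \<open>Rank and index of the stabilizers\<close>

lemma st_group: "group (Grig\<lparr>carrier := st v\<rparr>)"
  using U.subgroup_imp_group[OF st_subgroup] by (simp add: Grig_def)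

lemma Grig_mult: "f \<in> Gr \<Longrightarrow> g \<in> Gr \<Longrightarrow> f \<otimes>\<^bsub>Grig\<^esub> g = f \<circ> g"
  using mult_U[of f g] Gr_bij by (simp add: Grig_def)

lemma st_mult: "f \<in> st v \<Longrightarrow> g \<in> st v \<Longrightarrow> f \<otimes>\<^bsub>Grig\<^esub> g = f \<circ> g"
  using Grig_mult by (simp add: st_def)

lemma d_st_replicate: "d_st (replicate n True) = n + 3"
proof -
  let ?v = "replicate n True"
  let ?P = "Grig\<lparr>carrier := st ?v\<rparr>"
  interpret P: group ?P
    by (rule st_group)
  obtain x0 x1 x2 R where R: "finite R" "card R \<le> n" "{x0, x1, x2} \<union> R \<subseteq> st ?v"
    "generate U ({x0, x1, x2} \<union> R) = st ?v"
    using st_generators[of n] by blast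
  let ?S = "{x0, x1, x2} \<union> R"
  have S: "?S \<subseteq> carrier ?P" "finite ?S" "generate ?P ?S = carrier ?P"
    using R U.generate_consistent[OF R(3) st_subgroup] by (auto simp: Grig_def)
  have "card ?S \<le> card {x0, x1, x2} + card R"
    by (rule card_Un_le)
  also have "\<dots> \<le> n + 3"
    using R(2) card_length[of "[x0, x1, x2]"] by simp
  finally have "d_st ?v \<le> n + 3"
    using min_gens_le[OF S] by linarith
  moreover have "card {..<n + 3} \<le> d_st ?v"
  proof (rule P.min_gens_lower_bound[OF _ _ S])
    show "chi n (x \<otimes>\<^bsub>?P\<^esub> y) = sym_diff (chi n x) (chi n y)"
      if "x \<in> carrier ?P" "y \<in> carrier ?P" for x y
      using that by (simp add: st_mult chi_comp)
    show "Pow {..<n + 3} \<subseteq> chi n ` carrier ?P"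
      using chi_surj[of _ n] by auto
  qed
  ultimately show ?thesis by simp
qed

text \<open>Conjugation by \<open>k\<close> maps the stabilizer of \<open>v\<close> isomorphically
  onto that of \<open>k v\<close>.\<close>

lemma d_st_conj:
  assumes "k \<in> Gr"
  shows "d_st v = d_st (k v)"
proof -
  obtain k' where k': "k' \<in> Gr" "k' \<circ> k = id" "k \<circ> k' = id"
    using subgroup_U_inv[OF Gr_subgroup assms] .
  have kk: "k' (k w) = w" "k (k' w) = w" for w
    using k' by (metis comp_apply id_apply)+
  let ?\<phi> = "\<lambda>g. k \<circ> g \<circ> k'"
  have "bij_betw ?\<phi> (st v) (st (k v))"
    by (rule bij_betw_byWitness[where f' = "\<lambda>g. k' \<circ> g \<circ> k"])
      (auto simp: st_def kk assms k' fun_eq_iff)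
  moreover have closed: "?\<phi> g \<in> st (k v)" if "g \<in> st v" for g
    using that by (auto simp: st_def kk assms k')
  moreover have "?\<phi> (f \<otimes>\<^bsub>Grig\<^esub> g) = ?\<phi> f \<otimes>\<^bsub>Grig\<^esub> ?\<phi> g"
    if "f \<in> st v" "g \<in> st v" for f g
  proof -
    have "?\<phi> (f \<otimes>\<^bsub>Grig\<^esub> g) = ?\<phi> f \<circ> ?\<phi> g"
      unfolding st_mult[OF that] by (simp add: fun_eq_iff kk)
    also have "\<dots> = ?\<phi> f \<otimes>\<^bsub>Grig\<^esub> ?\<phi> g"
      by (rule st_mult[OF closed[OF that(1)] closed[OF that(2)], symmetric])
    finally show ?thesis .
  qed
  ultimately have "?\<phi> \<in> iso (Grig\<lparr>carrier := st v\<rparr>) (Grig\<lparr>carrier := st (k v)\<rparr>)"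
    by (auto simp: iso_def hom_def)
  then show ?thesis
    by (rule min_gens_iso[OF st_group st_group])
qed

lemma d_st_eq: "d_st v = length v + 3"
  using Gr_transitive[of v] d_st_conj d_st_replicate by metis

text \<open>The right coset of \<open>k\<close> consists of the elements sending the preimage of
  \<open>v\<close> under \<open>k\<close> to \<open>v\<close>. By transitivity every word of the
  same length occurs as such a preimage.\<close>

lemma index_st_eq: "index_st v = 2 ^ length v"
proof -
  let ?W = "{w :: bool list. length w = length v}"
  let ?f = "\<lambda>w. {g \<in> Gr. g w = v}"
  have trans: "\<exists>g \<in> Gr. g w = v" if w: "length w = length v" for w
  proof -
    obtain g h where gh: "g \<in> Gr" "h \<in> Gr" "g w = replicate (length v) True"
      "h v = replicate (length v) True"
      using Gr_transitive[of w] Gr_transitive[of v] unfolding w by blast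
    obtain h' where h': "h' \<in> Gr" "h' \<circ> h = id"
      using subgroup_U_inv[OF Gr_subgroup gh(2)] by metis
    have "h' (h v) = v"
      using h'(2) by (metis comp_apply id_apply)
    then show ?thesis
      using gh h'(1) by (intro bexI[of _ "h' \<circ> g"]) auto
  qed
  have coset: "st v #>\<^bsub>Grig\<^esub> k = ?f w" if k: "k \<in> Gr" "k w = v" for k w
  proof
    show "st v #>\<^bsub>Grig\<^esub> k \<subseteq> ?f w"
      using k by (auto simp: r_coset_def st_def Grig_mult)
    show "?f w \<subseteq> st v #>\<^bsub>Grig\<^esub> k"
    proof
      fix g assume g: "g \<in> ?f w"
      obtain k' where k': "k' \<in> Gr" "k' \<circ> k = id"
        using subgroup_U_inv[OF Gr_subgroup k(1)] by metis
      have kk: "k' (k w) = w" for w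
        using k'(2) by (metis comp_apply id_apply)
      have "g \<circ> k' \<in> st v"
        using g k' k(2) kk[of w] by (auto simp: st_def)
      moreover have "g = (g \<circ> k') \<otimes>\<^bsub>Grig\<^esub> k"
        using g k' k(1) by (simp add: Grig_mult fun_eq_iff kk)
      ultimately show "g \<in> st v #>\<^bsub>Grig\<^esub> k"
        by (auto simp: r_coset_def)
    qed
  qed
  have "rcosets\<^bsub>Grig\<^esub> (st v) = ?f ` ?W"
  proof
    show "rcosets\<^bsub>Grig\<^esub> (st v) \<subseteq> ?f ` ?W"
    proof
      fix C assume "C \<in> rcosets\<^bsub>Grig\<^esub> (st v)"
      then obtain k where k: "k \<in> Gr" "C = st v #>\<^bsub>Grig\<^esub> k"
        by (auto simp: RCOSETS_def)
      obtain k' where k': "k' \<in> Gr" "k \<circ> k' = id"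
        using subgroup_U_inv[OF Gr_subgroup k(1)] by metis
      have "k (k' v) = v"
        using k'(2) by (metis comp_apply id_apply)
      then show "C \<in> ?f ` ?W"
        using coset[OF k(1), of "k' v"] k(2) Gr_length[OF k'(1)] by auto
    qed
    show "?f ` ?W \<subseteq> rcosets\<^bsub>Grig\<^esub> (st v)"
    proof (rule image_subsetI)
      fix w assume "w \<in> ?W"
      then obtain k where k: "k \<in> Gr" "k w = v"
        using trans by blast
      then show "?f w \<in> rcosets\<^bsub>Grig\<^esub> (st v)"
        unfolding coset[OF k, symmetric] by (auto simp: RCOSETS_def)
    qed
  qed
  moreover have "inj_on ?f ?W"
  proof (rule inj_onI)
    fix w w' assume w: "w \<in> ?W" "?f w = ?f w'"
    then obtain g where g: "g \<in> Gr" "g w = v"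
      using trans by blast
    then have "g w' = v"
      using w(2) by blast
    then show "w = w'"
      using g Gr_bij[OF g(1)] by (metis bij_is_inj injD)
  qed
  moreover have "card ?W = 2 ^ length v"
    using card_lists_length_eq[of "UNIV :: bool set" "length v"] by simp
  ultimately show ?thesis
    by (simp add: card_image)
qed

theorem theorem1p4:
  shows "(\<exists>D::real. D > 0 \<and>
            (\<forall>v. log 2 (log 2 (real (index_st v))) \<le> D * log 2 (real (d_st v))) \<and>
            (\<forall>v. length v \<ge> 2 \<longrightarrow>
               (1 / D) * log 2 (real (d_st v)) \<le> log 2 (log 2 (real (index_st v))))) \<and>
         (\<forall>n v. n \<ge> 2 \<and> length v = n \<longrightarrow>
            (real (d_st v) - 1) / real (index_st v) = (real n + 2) / 2 ^ n)"
proof -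
  have idx: "log 2 (real (index_st v)) = real (length v)" for v
    by (simp add: index_st_eq log_nat_power)
  have "log 2 (real n) \<le> 3 * log 2 (real n + 3)" for n
  proof (cases "n = 0")
    case False
    then have "log 2 (real n) \<le> log 2 (real n + 3)" "0 \<le> log 2 (real n + 3)"
      by simp_all
    then show ?thesis by linarith
  \<comment> \<open>At the root \<open>log 2 0\<close> is 0 by convention, and the right-hand side
    is nonnegative.\<close>
  qed (simp add: log_def)
  \<comment> \<open>The constant 3 is the least integer exponent \<open>k\<close> with
    \<open>n + 3 \<le> n ^ k\<close> for all \<open>n \<ge> 2\<close>; the exponent 2 fails at
    \<open>n = 2\<close>.\<close>
  moreover have "1 / 3 * log 2 (real n + 3) \<le> log 2 (real n)" if "n \<ge> 2" for n
  proof -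
    have "2 ^ 2 * real n \<le> real n ^ 2 * real n"
      using that by (intro mult_right_mono power_mono) auto
    also have "\<dots> = real n ^ 3"
      by (simp add: power2_eq_square power3_eq_cube)
    finally have "real n + 3 \<le> real n ^ 3"
      using that by simp
    then have "log 2 (real n + 3) \<le> log 2 (real n ^ 3)"
      using that by simp
    then show ?thesis
      using that by (simp add: log_nat_power)
  qed
  ultimately show ?thesis
    unfolding idx by (intro conjI exI[of _ "3::real"]) (auto simp: d_st_eq index_st_eq)
qed

end
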